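(* Let $X$ and $Z$ be (real) Fréchet spaces, $C\subseteq Z$ a nonempty convex cone, $S\subseteq X$ a nonempty convex and closed set, $f:X\to\overline{\mathbb R}$ a proper, convex and lower semicontinuous function and $g:X\to Z^\bullet$ a proper, $C$-convex and $C$-epi closed function, with $\operatorname{dom}f\cap S\cap g^{-1}(-C)\neq\emptyset$ and $v(P_L)\in\mathbb R$. Put $G:=g(\operatorname{dom}f\cap S\cap\operatorname{dom}g)+C$ and consider the conditions: (RC1) there exists $x'\in\operatorname{dom}f\cap S$ such that $g(x')\in-\operatorname{int}(C)$; (RC2) $0\in\operatorname{int}(G)$; (RC3) $0\in\operatorname{core}(G)$; (RC6) $0\in\operatorname{qi}(G)$ and $(0,0)\notin\operatorname{qri}[\operatorname{co}(\mathcal E\cup\{(0,0)\})]$; (RC7) $0\in\operatorname{qi}(G-G)$, $0\in\operatorname{qri}(G)$ and $(0,0)\notin\operatorname{qri}[\operatorname{co}(\mathcal E\cup\{(0,0)\})]$. Then (RC1) $\Rightarrow$ (RC2) $\Leftrightarrow$ (RC3) $\Rightarrow$ (RC6) $\Leftrightarrow$ (RC7).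
   Context: $\overline{\mathbb R}=\mathbb R\cup\{\pm\infty\}$. A convex cone $C$ satisfies $\operatorname{cone}(C)\subseteq C$ and $C+C\subseteq C$, where $\operatorname{cone}(U)=\bigcup_{t\ge0}tU$. $C$ induces $z_1\le_C z_2\iff z_2-z_1\in C$. $Z^\bullet=Z\cup\{\infty_C\}$ with $\infty_C$ an abstract greatest element for $\le_C$, and $z+\infty_C=\infty_C+z=\infty_C$, $t\,\infty_C=\infty_C$ for all $z\in Z^\bullet$, $t\ge0$. $\operatorname{dom}f=\{x:f(x)<+\infty\}$; $f$ is proper if $\operatorname{dom}f\ne\emptyset$ and $f>-\infty$ everywhere. $\operatorname{dom}g=\{x:g(x)\in Z\}$; $g$ is proper if $\operatorname{dom}g\neq\emptyset$; $g$ is $C$-convex if $g(tx+(1-t)y)\le_C tg(x)+(1-t)g(y)$ for all $x,y\in X$, $t\in[0,1]$; $g$ is $C$-epi closed if $\{(x,z)\in X\times Z:g(x)\le_C z\}$ is closed in $X\times Z$. $v(P_L)=\inf\{f(x):x\in S,\ g(x)\in-C\}$. $\mathcal E:=\{(g(x)+z,\ f(x)-v(P_L)+\varepsilon):x\in\operatorname{dom}f\cap S\cap\operatorname{dom}g,\ z\in C,\ \varepsilon\ge0\}\subseteq Z\times\mathbb R$. For a nonempty convex subset $U$ of a separated locally convex space $V$: $\operatorname{core}(U)=\{u\in U:\operatorname{cone}(U-u)=V\}$; $\operatorname{qi}(U)=\{u\in U:\operatorname{cl}(\operatorname{cone}(U-u))=V\}$; $\operatorname{qri}(U)=\{u\in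 U:\operatorname{cl}(\operatorname{cone}(U-u))\text{ is a linear subspace of }V\}$. $\operatorname{int}$ is the interior, $\operatorname{co}$ the convex hull, $\operatorname{cl}$ the closure. *)

theory Defs
  imports "HOL-Analysis.Analysis"
begin

section \<open>Frechet spaces\<close>

class real_tvs = real_vector + topological_ab_group_add +
  assumes tendsto_scaleR_Pair:
    "LIM p (nhds (a::real) \<times>\<^sub>F nhds x). fst p *\<^sub>R snd p :> nhds (a *\<^sub>R x)"

text \<open>
  The convexity of \<open>V\<close> is spelled out because \<^const>\<open>convex\<close> is not available in a class
  specification.
\<close>

class locally_convex_tvs = real_tvs +
  assumes locally_convex:
    "open U \<Longrightarrow> 0 \<in> U \<Longrightarrow> \<exists>V. open V \<and> 0 \<in> V \<and> V \<subseteq> U \<and>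
       (\<forall>x\<in>V. \<forall>y\<in>V. \<forall>u\<ge>0. \<forall>v\<ge>0. u + v = 1 \<longrightarrow> u *\<^sub>R x + v *\<^sub>R y \<in> V)"

text \<open>
  The metric is existentially quantified: a Frechet space is a topological vector space and
  carries no distinguished metric. The Hausdorff property follows from metrizability. The term
  \<open>topology open\<close> is the unfolding of \<^term>\<open>euclidean\<close>, the topology of the type.
\<close>

class frechet_space = locally_convex_tvs +
  assumes complete_invariant_metric:
    "\<exists>d. Metric_space UNIV d \<and>
         (\<forall>x y z. d (x + z) (y + z) = d x y) \<and>
         Metric_space.mcomplete UNIV d \<and>
         Metric_space.mtopology UNIV d = topology open"

section \<open>Cones and generalized interiors\<close>

definition cone_of :: "'a::real_vector set \<Rightarrow> 'a set" where
  "cone_of U = (\<Union>t\<in>{0..}. (\<lambda>u. t *\<^sub>R u) ` U)"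

text \<open>Here \<open>+\<close> is the elementwise sum of sets.\<close>

definition is_convex_cone :: "'a::real_vector set \<Rightarrow> bool" where
  "is_convex_cone C \<longleftrightarrow> cone_of C \<subseteq> C \<and> C + C \<subseteq> C"

definition core :: "'a::real_vector set \<Rightarrow> 'a set" where
  "core U = {u \<in> U. cone_of ((\<lambda>x. x - u) ` U) = UNIV}"

definition qi :: "'a::{real_vector,topological_space} set \<Rightarrow> 'a set" where
  "qi U = {u \<in> U. closure (cone_of ((\<lambda>x. x - u) ` U)) = UNIV}"

definition qri :: "'a::{real_vector,topological_space} set \<Rightarrow> 'a set" where
  "qri U = {u \<in> U. subspace (closure (cone_of ((\<lambda>x. x - u) ` U)))}"

text \<open>On sets, the operator \<open>-\<close> is set-theoretic difference, so \<open>U - V\<close> cannot be used for this.\<close>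

definition set_diff_of :: "'a::minus set \<Rightarrow> 'a set \<Rightarrow> 'a set" where
  "set_diff_of U V = {u - v | u v. u \<in> U \<and> v \<in> V}"

section \<open>Extended real-valued functions\<close>

definition edom :: "('x \<Rightarrow> ereal) \<Rightarrow> 'x set" where
  "edom f = {x. f x < \<infinity>}"

definition eproper :: "('x \<Rightarrow> ereal) \<Rightarrow> bool" where
  "eproper f \<longleftrightarrow> edom f \<noteq> {} \<and> (\<forall>x. f x > -\<infinity>)"

text \<open>
  Only used for functions that never take the value \<open>-\<infinity>\<close>. The library convention
  \<open>0 * \<infinity> = 0\<close> is then harmless, since for \<open>t \<in> {0, 1}\<close> the inequality is trivial.
\<close>

definition econvex :: "('x::real_vector \<Rightarrow> ereal) \<Rightarrow> bool" where
  "econvex f \<longleftrightarrow>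
     (\<forall>x y. \<forall>t\<in>{0..1}. f (t *\<^sub>R x + (1 - t) *\<^sub>R y) \<le> ereal t * f x + ereal (1 - t) * f y)"

definition lsc :: "('x::topological_space \<Rightarrow> ereal) \<Rightarrow> bool" where
  "lsc f \<longleftrightarrow> (\<forall>x a. a < f x \<longrightarrow> (\<forall>\<^sub>F y in nhds x. a < f y))"

section \<open>Functions into a cone-ordered space with a greatest element\<close>

datatype 'z with_top = Elem 'z | Top

fun top_add :: "'z::plus with_top \<Rightarrow> 'z with_top \<Rightarrow> 'z with_top" where
  "top_add (Elem a) (Elem b) = Elem (a + b)"
| "top_add Top _ = Top"
| "top_add _ Top = Top"

text \<open>In particular \<open>top_scale 0 Top = Top\<close>.\<close>

fun top_scale :: "real \<Rightarrow> 'z::real_vector with_top \<Rightarrow> 'z with_top" where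
  "top_scale t (Elem a) = Elem (t *\<^sub>R a)"
| "top_scale t Top = Top"

fun top_le :: "'z::minus set \<Rightarrow> 'z with_top \<Rightarrow> 'z with_top \<Rightarrow> bool" where
  "top_le C (Elem a) (Elem b) \<longleftrightarrow> b - a \<in> C"
| "top_le C _ Top \<longleftrightarrow> True"
| "top_le C Top (Elem b) \<longleftrightarrow> False"

definition tdom :: "('x \<Rightarrow> 'z with_top) \<Rightarrow> 'x set" where
  "tdom g = {x. g x \<in> range Elem}"

definition tproper :: "('x \<Rightarrow> 'z with_top) \<Rightarrow> bool" where
  "tproper g \<longleftrightarrow> tdom g \<noteq> {}"

definition cone_convex :: "'z::real_vector set \<Rightarrow> ('x::real_vector \<Rightarrow> 'z with_top) \<Rightarrow> bool" where
  "cone_convex C g \<longleftrightarrow>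
     (\<forall>x y. \<forall>t\<in>{0..1}. top_le C (g (t *\<^sub>R x + (1 - t) *\<^sub>R y))
                              (top_add (top_scale t (g x)) (top_scale (1 - t) (g y))))"

definition cone_epi_closed ::
    "'z::{real_vector,topological_space} set \<Rightarrow> ('x::topological_space \<Rightarrow> 'z with_top) \<Rightarrow> bool" where
  "cone_epi_closed C g \<longleftrightarrow> closed {(x, z). top_le C (g x) (Elem z)}"

section \<open>The primal problem and the regularity conditions\<close>

definition neg_top :: "'z::uminus set \<Rightarrow> 'z with_top set" where
  "neg_top U = (\<lambda>z. Elem (- z)) ` U"

definition vPL ::
    "'z::uminus set \<Rightarrow> 'x set \<Rightarrow> ('x \<Rightarrow> ereal) \<Rightarrow> ('x \<Rightarrow> 'z with_top) \<Rightarrow> ereal" where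
  "vPL C S f g = Inf {f x | x. x \<in> S \<and> g x \<in> neg_top C}"

definition Gset ::
    "'z::plus set \<Rightarrow> 'x set \<Rightarrow> ('x \<Rightarrow> ereal) \<Rightarrow> ('x \<Rightarrow> 'z with_top) \<Rightarrow> 'z set" where
  "Gset C S f g = {y + z | x y z. x \<in> edom f \<inter> S \<inter> tdom g \<and> g x = Elem y \<and> z \<in> C}"

text \<open>
  The conversion \<open>real_of_ereal\<close> is only applied to finite values when \<open>f\<close> is proper and the
  optimal value is finite.
\<close>

definition Eset ::
    "'z::{plus,uminus} set \<Rightarrow> 'x set \<Rightarrow> ('x \<Rightarrow> ereal) \<Rightarrow> ('x \<Rightarrow> 'z with_top) \<Rightarrow> ('z \<times> real) set" where
  "Eset C S f g =
     {(y + z, real_of_ereal (f x) - real_of_ereal (vPL C S f g) + e) | x y z e.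
        x \<in> edom f \<inter> S \<inter> tdom g \<and> g x = Elem y \<and> z \<in> C \<and> e \<ge> 0}"

definition RC1 ::
    "'z::{uminus,topological_space} set \<Rightarrow> 'x set \<Rightarrow> ('x \<Rightarrow> ereal) \<Rightarrow> ('x \<Rightarrow> 'z with_top) \<Rightarrow> bool" where
  "RC1 C S f g \<longleftrightarrow> (\<exists>x'\<in>edom f \<inter> S. g x' \<in> neg_top (interior C))"

definition RC2 ::
    "'z::{real_vector,topological_space} set \<Rightarrow> 'x set \<Rightarrow> ('x \<Rightarrow> ereal) \<Rightarrow> ('x \<Rightarrow> 'z with_top) \<Rightarrow> bool" where
  "RC2 C S f g \<longleftrightarrow> 0 \<in> interior (Gset C S f g)"

definition RC3 ::
    "'z::real_vector set \<Rightarrow> 'x set \<Rightarrow> ('x \<Rightarrow> ereal) \<Rightarrow> ('x \<Rightarrow> 'z with_top) \<Rightarrow> bool" where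
  "RC3 C S f g \<longleftrightarrow> 0 \<in> core (Gset C S f g)"

definition RC6 ::
    "'z::{real_vector,topological_space} set \<Rightarrow> 'x set \<Rightarrow> ('x \<Rightarrow> ereal) \<Rightarrow> ('x \<Rightarrow> 'z with_top) \<Rightarrow> bool" where
  "RC6 C S f g \<longleftrightarrow>
     0 \<in> qi (Gset C S f g) \<and>
     (0, 0) \<notin> qri (convex hull (Eset C S f g \<union> {(0, 0)}))"

definition RC7 ::
    "'z::{real_vector,topological_space} set \<Rightarrow> 'x set \<Rightarrow> ('x \<Rightarrow> ereal) \<Rightarrow> ('x \<Rightarrow> 'z with_top) \<Rightarrow> bool" where
  "RC7 C S f g \<longleftrightarrow>
     0 \<in> qi (set_diff_of (Gset C S f g) (Gset C S f g)) \<and>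
     0 \<in> qri (Gset C S f g) \<and>
     (0, 0) \<notin> qri (convex hull (Eset C S f g \<union> {(0, 0)}))"

end

theory Submission
  imports Defs
begin

text \<open>
  The set \<open>G\<close> and the set \<open>\<E>\<close> are two shadows of one convex set, the epigraph
  \<open>{(x, z, r). x \<in> S, f x \<le> r, g x \<le>\<^sub>C z}\<close> of the perturbed problem: \<open>G\<close> is its projection to \<open>z\<close>
  (\<open>Gset_eq\<close>), and \<open>\<E>\<close> is its projection to \<open>(z, r)\<close>, shifted by the optimal value (\<open>Eset_iff\<close>). So
  \<open>\<E>\<close> is convex, and by definition of the optimal value it has no point \<open>(0, r)\<close> with \<open>r < 0\<close>.

  The hard implication is from \<open>0 \<in> core G\<close> to \<open>0 \<in> int G\<close>. It is the theorem of Robinson and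
  Ursescu: if a closed convex subset of a product of two Frechet spaces has \<open>0\<close> in the core of its
  projection to the second factor, then \<open>0\<close> is in the interior of this projection
  (\<open>closed_convex_range_core_imp_interior\<close>). Baire's theorem turns absorbing sets into sets whose
  closures are neighbourhoods of \<open>0\<close>, and a series of successive corrections, summable by
  completeness, removes the closures.

  This theorem is applied to the slice \<open>r = m\<close> of the epigraph for one large \<open>m\<close>, rather than to the
  whole epigraph. Moving from a feasible point towards other points by small steps costs little in
  \<open>f\<close>, so \<open>0\<close> is also in the core of the projection of the slice. The gain is twofold: the slice lives
  in a product of the two given spaces, and a neighbourhood of \<open>0\<close> in its projection is a
  neighbourhood over which the value function of the problem is bounded by \<open>m\<close>
  (\<open>core_Gset_imp_interior_slice\<close>).

  This bound also gives the condition on \<open>\<E>\<close>. If \<open>(0, 0)\<close> were in the quasi-relative interior, then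
  \<open>(0, -1)\<close> would be a limit of points of the cone generated by \<open>\<E>\<close>, because \<open>(0, 1)\<close> lies in that
  cone. A convex function that is bounded above near \<open>0\<close> and is nonnegative at \<open>0\<close> cannot decrease
  that fast from \<open>0\<close> in nearly vertical directions (\<open>not_qri_of_locally_bounded\<close>).

  The last equivalence is formal: if the closed cone generated by \<open>G\<close> is a subspace, it contains
  all differences of elements of \<open>G\<close>.
\<close>

section \<open>Topological vector spaces\<close>

lemma tendsto_scaleR_tvs:
  fixes x :: "'a::real_tvs"
  assumes "(c \<longlongrightarrow> a) F" "(h \<longlongrightarrow> x) F"
  shows "((\<lambda>t. c t *\<^sub>R h t) \<longlongrightarrow> a *\<^sub>R x) F"
  using filterlim_compose[OF tendsto_scaleR_Pair filterlim_Pair[OF assms]] by simp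

lemma continuous_on_affine_tvs: "continuous_on A (\<lambda>x::'a::real_tvs. a *\<^sub>R x + b)"
  unfolding continuous_on_def
  by (intro ballI tendsto_add tendsto_scaleR_tvs tendsto_const tendsto_ident_at)

lemma open_affine_vimage: "open U \<Longrightarrow> open {x::'a::real_tvs. a *\<^sub>R x + b \<in> U}"
  using open_vimage[OF _ continuous_on_affine_tvs] by (simp add: vimage_def)

lemma closed_affine_vimage: "closed U \<Longrightarrow> closed {x::'a::real_tvs. a *\<^sub>R x + b \<in> U}"
  using closed_vimage[OF _ continuous_on_affine_tvs] by (simp add: vimage_def)

lemma nhd_absorbing:
  fixes z :: "'a::real_tvs"
  assumes "open U" "0 \<in> U"
  obtains t where "t > 0" "t *\<^sub>R z \<in> U"
proof -
  have "((\<lambda>t. t *\<^sub>R z) \<longlongrightarrow> 0 *\<^sub>R z) (at_right (0::real))"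
    by (intro tendsto_scaleR_tvs tendsto_const tendsto_ident_at)
  then have "\<forall>\<^sub>F t in at_right (0::real). t *\<^sub>R z \<in> U"
    using assms by (auto simp: tendsto_def)
  then have "\<forall>\<^sub>F t in at_right (0::real). t *\<^sub>R z \<in> U \<and> t > 0"
    using eventually_at_right_less by (rule eventually_conj)
  then show ?thesis
    using that eventually_happens'[OF trivial_limit_at_right_real] by blast
qed

lemma cone_of_absorbing: "cone_of U = UNIV \<longleftrightarrow> (\<forall>z. \<exists>t\<ge>0. \<exists>u\<in>U. z = t *\<^sub>R u)"
  proof -
  have "z \<in> cone_of U \<longleftrightarrow> (\<exists>t\<ge>0. \<exists>u\<in>U. z = t *\<^sub>R u)" for z
    unfolding cone_of_def by (auto simp: image_iff)
  then show ?thesis by (simp add: set_eq_iff)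
qed

lemma core_0_iff: "0 \<in> core U \<longleftrightarrow> 0 \<in> U \<and> (\<forall>z. \<exists>t\<ge>0. \<exists>u\<in>U. z = t *\<^sub>R u)"
  unfolding core_def cone_of_absorbing by simp

lemma interior_0_imp_core_0:
  fixes U :: "'a::real_tvs set"
  assumes "0 \<in> interior U"
  shows "0 \<in> core U"
  unfolding core_0_iff
proof (intro conjI allI)
  show "0 \<in> U" using assms interior_subset by blast
  fix z
  obtain t where "t > 0" "t *\<^sub>R z \<in> interior U"
    using nhd_absorbing[OF open_interior assms] .
  then have "inverse t \<ge> 0" "t *\<^sub>R z \<in> U" "z = inverse t *\<^sub>R (t *\<^sub>R z)"
    using interior_subset by auto
  then show "\<exists>t\<ge>0. \<exists>u\<in>U. z = t *\<^sub>R u" by blast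
qed

lemma convex_scale_mem:
  assumes "convex A" "0 \<in> A" "a \<in> A" "0 \<le> s" "s \<le> 1"
  shows "s *\<^sub>R a \<in> A"
  using convexD[OF assms(1,3,2), of s "1 - s"] assms(4,5) by simp

section \<open>Consequences of completeness\<close>

lemma frechet_baire:
  fixes T :: "nat \<Rightarrow> 'a::frechet_space set"
  assumes "\<And>n. closed (T n)" "(\<Union>n. T n) = UNIV"
  obtains n where "interior (T n) \<noteq> {}"
proof -
  obtain d :: "'a \<Rightarrow> 'a \<Rightarrow> real" where d: "Metric_space UNIV d"
    "Metric_space.mcomplete UNIV d" "Metric_space.mtopology UNIV d = euclidean"
    using complete_invariant_metric by blast
  have "euclidean interior_of \<Union>(range T) = {}" if "\<forall>n. interior (T n) = {}"
    using that assms(1) Metric_space.metric_Baire_category_alt[OF d(1,2), of "range T"]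
    unfolding d(3) by auto
  then show ?thesis using that assms(2) by auto
qed

text \<open>
  The space is the union of the multiples of \<open>closure A\<close>, so by Baire's theorem one of them, hence
  \<open>closure A\<close> itself, has an interior point \<open>z'\<close>. Since \<open>A\<close> contains a positive multiple of \<open>- z'\<close>
  (or \<open>z' = 0\<close>), a contraction of the space towards this multiple moves \<open>z'\<close> to \<open>0\<close> and maps
  \<open>closure A\<close> into itself.
\<close>

lemma core_0_imp_interior_closure_0:
  fixes A :: "'a::frechet_space set"
  assumes "convex A" and core: "0 \<in> core A"
  shows "0 \<in> interior (closure A)"
proof -
  have 0: "0 \<in> A" and abs: "\<And>z. \<exists>t\<ge>0. \<exists>u\<in>A. z = t *\<^sub>R u"
    using core unfolding core_0_iff by auto
  define T where "T n = {x. (1 / real (Suc n)) *\<^sub>R x + 0 \<in> closure A}" for n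
  have "x \<in> (\<Union>n. T n)" for x
  proof -
    obtain t u where t: "t \<ge> 0" "u \<in> A" "x = t *\<^sub>R u" using abs by blast
    obtain n where "t \<le> real n" using real_arch_simple by blast
    then have "(t / real (Suc n)) *\<^sub>R u \<in> A"
      using t by (intro convex_scale_mem[OF assms(1) 0]) (auto simp: field_simps)
    then have "x \<in> T n" using t closure_subset by (auto simp: T_def)
    then show ?thesis by blast
  qed
  moreover have "closed (T n)" for n
    unfolding T_def by (intro closed_affine_vimage closed_closure)
  ultimately obtain n where "interior (T n) \<noteq> {}"
    using frechet_baire[of T] by (metis UNIV_eq_I)
  then obtain z where z: "z \<in> interior (T n)" by auto
  define z' where "z' = (1 / real (Suc n)) *\<^sub>R z"
  obtain t a where t: "t \<ge> 0" "a \<in> A" "- z' = t *\<^sub>R a" using abs by blast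
  define k where "k = real (Suc n)"
  have k: "k > 0" by (simp add: k_def)
  \<comment> \<open>\<open>U\<close> is the image of \<open>interior (T n)\<close> under \<open>z \<mapsto> (z / k + t a) / (1 + t)\<close>.\<close>
  define U where "U = {w. (k * (1 + t)) *\<^sub>R w + (- (k * t)) *\<^sub>R a \<in> interior (T n)}"
  have "open U" unfolding U_def by (intro open_affine_vimage open_interior)
  moreover have "0 \<in> U"
  proof -
    have "z = k *\<^sub>R z'" by (simp add: z'_def k_def)
    also have "\<dots> = k *\<^sub>R (- (t *\<^sub>R a))" using t(3) by (metis minus_minus)
    finally have "z = (- (k * t)) *\<^sub>R a" by simp
    then show ?thesis using z by (simp add: U_def)
  qed
  moreover have "U \<subseteq> closure A"
  proof
    fix w assume "w \<in> U"
    define x where "x = (1 + t) *\<^sub>R w - t *\<^sub>R a"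
    have "(k * (1 + t)) *\<^sub>R w + (- (k * t)) *\<^sub>R a \<in> T n"
      using \<open>w \<in> U\<close> interior_subset unfolding U_def by blast
    then have "(1 / k) *\<^sub>R ((k * (1 + t)) *\<^sub>R w + (- (k * t)) *\<^sub>R a) \<in> closure A"
      by (simp add: T_def k_def)
    moreover have "(1 / k) *\<^sub>R ((k * (1 + t)) *\<^sub>R w + (- (k * t)) *\<^sub>R a) = x"
      using k by (simp add: x_def scaleR_right_diff_distrib)
    ultimately have x: "x \<in> closure A" by simp
    have "(\<lambda>y. (1 / (1 + t)) *\<^sub>R y + (t / (1 + t)) *\<^sub>R a) ` closure A \<subseteq> closure A"
    proof (rule image_closure_subset[OF continuous_on_affine_tvs closed_closure])
      have "(1 / (1 + t)) *\<^sub>R y + (t / (1 + t)) *\<^sub>R a \<in> A" if "y \<in> A" for y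
        using t that by (intro convexD[OF assms(1)]) (auto simp: field_simps)
      then show "(\<lambda>y. (1 / (1 + t)) *\<^sub>R y + (t / (1 + t)) *\<^sub>R a) ` A \<subseteq> closure A"
        using closure_subset by blast
    qed
    then have "(1 / (1 + t)) *\<^sub>R x + (t / (1 + t)) *\<^sub>R a \<in> closure A" using x by blast
    moreover have "(1 / (1 + t)) *\<^sub>R x + (t / (1 + t)) *\<^sub>R a = w"
      using t(1) by (simp add: x_def scaleR_right_diff_distrib)
    ultimately show "w \<in> closure A" by simp
  qed
  ultimately show ?thesis by (meson interiorI)
qed

text \<open>
  Inside the balls of radius \<open>(1/2)^n\<close> of a complete metric, the partial sums are Cauchy sequences:
  translation invariance makes the distance of consecutive partial sums equal to the distance of
  the added term from \<open>0\<close>. Stating completeness by such neighbourhoods keeps the metric out of the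
  later arguments: they ensure both that a series converges and that its terms tend to \<open>0\<close>.
\<close>

lemma frechet_summable_nhds:
  "\<exists>V :: nat \<Rightarrow> 'a::frechet_space set.
     (\<forall>n. open (V n) \<and> 0 \<in> V n \<and> convex (V n)) \<and>
     (\<forall>y. (\<forall>n. y n \<in> V n) \<longrightarrow> summable y)"
proof -
  obtain d :: "'a \<Rightarrow> 'a \<Rightarrow> real" where d: "Metric_space UNIV d"
    and inv: "\<And>x y z. d (x + z) (y + z) = d x y"
    and complete: "Metric_space.mcomplete UNIV d"
    and top: "Metric_space.mtopology UNIV d = euclidean"
    using complete_invariant_metric by blast
  interpret M: Metric_space UNIV d by (rule d)
  have "\<exists>V. open V \<and> 0 \<in> V \<and> V \<subseteq> M.mball 0 ((1/2)^n) \<and> convex V" for n :: nat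
  proof -
    have "open (M.mball 0 ((1/2)^n))"
      using M.openin_mball unfolding top by simp
    moreover have "0 \<in> M.mball 0 ((1/2)^n)" by simp
    ultimately show ?thesis using locally_convex unfolding convex_def by blast
  qed
  then obtain V where V: "\<And>n. open (V n)" "\<And>n. 0 \<in> V n"
    "\<And>n. V n \<subseteq> M.mball 0 ((1/2)^n)" "\<And>n. convex (V n)" by metis
  have "summable y" if y: "\<And>n. y n \<in> V n" for y
  proof -
    define s where "s n = (\<Sum>k<n. y k)" for n
    have step: "d (s (Suc n)) (s n) < (1/2)^n" for n
    proof -
      have "d (s (Suc n)) (s n) = d 0 (y n)"
        using inv[of "y n" "s n" 0] by (simp add: s_def M.commute add.commute)
      then show ?thesis using y V(3) by fastforce
    qed
    have tail: "d (s n) (s (n + j)) \<le> 2 * (1/2)^n - 2 * (1/2)^(n+j)" for n j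
    proof (induction j)
      case (Suc j)
      have "d (s n) (s (n + Suc j)) \<le> d (s n) (s (n + j)) + d (s (n + j)) (s (n + Suc j))"
        using M.triangle by simp
      then show ?case using Suc step[of "n + j"] by (simp add: M.commute)
    qed simp
    have "M.MCauchy s"
      unfolding M.MCauchy_def
    proof (intro conjI allI impI)
      fix e :: real assume "e > 0"
      then obtain N where N: "(1/2)^N < e / 4"
        using real_arch_pow_inv[of "e / 4" "1/2"] by auto
      have near: "d (s N) (s n) < e / 2" if "N \<le> n" for n
      proof -
        have "0 < (1/2::real)^n" by simp
        then show ?thesis using tail[of N "n - N"] that N unfolding le_add_diff_inverse[OF that] by linarith
      qed
      have "d (s n) (s n') < e" if "N \<le> n" "N \<le> n'" for n n'
        using near[OF that(1)] near[OF that(2)] M.triangle[of "s n" "s N" "s n'"]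
        by (simp add: M.commute)
      then show "\<exists>N. \<forall>n n'. N \<le> n \<longrightarrow> N \<le> n' \<longrightarrow> d (s n) (s n') < e" by blast
    qed simp
    then have "\<exists>l. limitin euclidean s l sequentially"
      using complete unfolding M.mcomplete_def top by blast
    then show ?thesis by (auto simp: summable_def sums_def s_def[abs_def])
  qed
  with V show ?thesis by (intro exI[of _ V]) simp
qed

lemma summable_imp_tendsto_0:
  fixes y :: "nat \<Rightarrow> 'a::topological_ab_group_add"
  assumes "summable y"
  shows "y \<longlonglongrightarrow> 0"
proof -
  obtain l where l: "(\<lambda>n. \<Sum>k<n. y k) \<longlonglongrightarrow> l"
    using assms by (auto simp: summable_def sums_def)
  have "(\<lambda>n. (\<Sum>k<Suc n. y k) + - (\<Sum>k<n. y k)) \<longlonglongrightarrow> l + - l"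
    by (intro tendsto_add tendsto_minus l LIMSEQ_Suc[OF l])
  then show ?thesis by simp
qed

section \<open>Projections of closed convex sets\<close>

lemma convex_sum_halves:
  assumes "convex K" "0 \<in> K" "\<And>k. p k \<in> K"
  shows "(\<Sum>k<n. (1/2)^(Suc k) *\<^sub>R p k) \<in> K"
  using assms(3)
proof (induction n arbitrary: p)
  case 0
  then show ?case using assms(2) by simp
next
  case (Suc n)
  have "(\<Sum>k<Suc n. (1/2)^(Suc k) *\<^sub>R p k)
      = (1/2) *\<^sub>R p 0 + (1/2) *\<^sub>R (\<Sum>k<n. (1/2)^(Suc k) *\<^sub>R p (Suc k))"
    unfolding sum.lessThan_Suc_shift by (simp add: scaleR_sum_right)
  moreover have "(\<Sum>k<n. (1/2)^(Suc k) *\<^sub>R p (Suc k)) \<in> K"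
    by (rule Suc.IH) (rule Suc.prems)
  then have "(1/2) *\<^sub>R p 0 + (1/2) *\<^sub>R (\<Sum>k<n. (1/2)^(Suc k) *\<^sub>R p (Suc k)) \<in> K"
    by (intro convexD[OF assms(1) Suc.prems[of 0]]) auto
  ultimately show ?case by (simp only:)
qed

text \<open>
  Let \<open>A n\<close> be the projection of the part of \<open>K\<close> over \<open>V n\<close>. It is convex and absorbing, so its
  closure contains a neighbourhood \<open>W n\<close> of \<open>0\<close>. Given \<open>u 0 = 2 z\<close> in \<open>W 0\<close>, an approximation
  of \<open>u n\<close> by the second component of some \<open>p n \<in> K\<close> is chosen so close that the doubled error
  \<open>u (n + 1)\<close> lies in \<open>W (n + 1)\<close>. Then \<open>z\<close> is the sum of the series of the \<open>snd (p n) / 2^(n+1)\<close>.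
  The partial sums of \<open>p n / 2^(n+1)\<close> stay in \<open>K\<close> because the weights add up to less than \<open>1\<close> and
  \<open>(0, 0) \<in> K\<close>; their first components converge by the choice of \<open>V\<close>, and \<open>K\<close> is closed.
\<close>

lemma closed_convex_range_interior_0:
  fixes K :: "('x::frechet_space \<times> 'z::frechet_space) set"
  assumes "closed K" "convex K" "(0, 0) \<in> K" and core: "0 \<in> core (snd ` K)"
  shows "0 \<in> interior (snd ` K)"
proof -
  obtain V :: "nat \<Rightarrow> 'x set" where
    V_all: "(\<forall>n. open (V n) \<and> 0 \<in> V n \<and> convex (V n)) \<and>
      (\<forall>y. (\<forall>n. y n \<in> V n) \<longrightarrow> summable y)"
    using frechet_summable_nhds ..
  then have V: "\<And>n. open (V n)" "\<And>n. 0 \<in> V n" "\<And>n. convex (V n)" by simp_all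
  obtain V' :: "nat \<Rightarrow> 'z set" where
    V'_all: "(\<forall>n. open (V' n) \<and> 0 \<in> V' n \<and> convex (V' n)) \<and>
      (\<forall>y. (\<forall>n. y n \<in> V' n) \<longrightarrow> summable y)"
    using frechet_summable_nhds ..
  then have V': "\<And>n. open (V' n)" "\<And>n. 0 \<in> V' n" by simp_all
  define A where "A n = snd ` (K \<inter> V n \<times> UNIV)" for n
  define W where "W n = interior (closure (A n)) \<inter> V' n" for n
  have A_int: "0 \<in> interior (closure (A n))" for n
  proof (rule core_0_imp_interior_closure_0)
    show "convex (A n)"
      unfolding A_def using V(3) assms(2)
      by (intro convex_linear_image linear_snd convex_Int convex_Times convex_UNIV)
    show "0 \<in> core (A n)"
      unfolding core_0_iff
    proof (intro conjI allI)
      show "0 \<in> A n" using assms(3) V(2) unfolding A_def by force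
      fix z
      obtain t x u where t: "t \<ge> 0" "(x, u) \<in> K" "z = t *\<^sub>R u"
        using core unfolding core_0_iff by force
      obtain r where r: "r > 0" "r *\<^sub>R x \<in> V n" using nhd_absorbing[OF V(1,2)] .
      define q where "q = min r 1"
      have q: "0 < q" "q \<le> 1" "q \<le> r" using r by (auto simp: q_def)
      have "(q / r) *\<^sub>R (r *\<^sub>R x) \<in> V n"
        using q r by (intro convex_scale_mem[OF V(3) V(2) r(2)]) auto
      then have "q *\<^sub>R x \<in> V n" using r by simp
      moreover have "q *\<^sub>R (x, u) \<in> K"
        using convex_scale_mem[OF assms(2) _ t(2)] assms(3) q by (simp add: zero_prod_def)
      ultimately have "q *\<^sub>R u \<in> A n" unfolding A_def by force
      moreover have "z = (t / q) *\<^sub>R (q *\<^sub>R u)" "t / q \<ge> 0" using t q by auto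
      ultimately show "\<exists>t\<ge>0. \<exists>u\<in>A n. z = t *\<^sub>R u" by blast
    qed
  qed
  have W: "open (W n)" "0 \<in> W n" "W n \<subseteq> closure (A n)" "W n \<subseteq> V' n" for n
    using A_int V' interior_subset[of "closure (A n)"] by (auto simp: W_def)
  \<comment> \<open>The factor 2 compensates for the first weight \<open>1/2\<close> of the series.\<close>
  have "z \<in> snd ` K" if z: "2 *\<^sub>R z \<in> W 0" for z
  proof -
    have "\<exists>u. \<forall>n. u n \<in> W n \<and> (n = 0 \<longrightarrow> u n = 2 *\<^sub>R z) \<and>
        (\<exists>p\<in>K. fst p \<in> V n \<and> u (Suc n) = 2 *\<^sub>R (u n - snd p))"
    proof -
      have "\<exists>u'. (u' \<in> W (Suc n) \<and> (Suc n = 0 \<longrightarrow> u' = 2 *\<^sub>R z)) \<and>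
          (\<exists>p\<in>K. fst p \<in> V n \<and> u' = 2 *\<^sub>R (u - snd p))" if "u \<in> W n" for u n
      proof -
        define N where "N = {w. (- 2) *\<^sub>R w + 2 *\<^sub>R u \<in> W (Suc n)}"
        have "open N" unfolding N_def by (intro open_affine_vimage W)
        moreover have "u \<in> N" using W by (simp add: N_def)
        moreover have "u \<in> closure (A n)" using that W by blast
        ultimately obtain w where w: "w \<in> N" "w \<in> A n"
          using open_Int_closure_eq_empty[of N "A n"] by blast
        then obtain p where "p \<in> K" "fst p \<in> V n" "w = snd p" unfolding A_def by auto
        moreover have "2 *\<^sub>R (u - w) \<in> W (Suc n)"
          using w by (simp add: N_def scaleR_right_diff_distrib)
        ultimately show ?thesis by blast
      qed
      then show ?thesis
        using dependent_nat_choice[of "\<lambda>n u. u \<in> W n \<and> (n = 0 \<longrightarrow> u = 2 *\<^sub>R z)"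
            "\<lambda>n u u'. \<exists>p\<in>K. fst p \<in> V n \<and> u' = 2 *\<^sub>R (u - snd p)"] z
        by simp
    qed
    then obtain u where u_all: "\<forall>n. u n \<in> W n \<and> (n = 0 \<longrightarrow> u n = 2 *\<^sub>R z) \<and>
        (\<exists>p\<in>K. fst p \<in> V n \<and> u (Suc n) = 2 *\<^sub>R (u n - snd p))" ..
    then have u: "\<And>n. u n \<in> W n" "u 0 = 2 *\<^sub>R z" by simp_all
    have "\<forall>n. \<exists>p. p \<in> K \<and> fst p \<in> V n \<and> u (Suc n) = 2 *\<^sub>R (u n - snd p)"
      using u_all by blast
    from choice[OF this] obtain p
      where "\<forall>n. p n \<in> K \<and> fst (p n) \<in> V n \<and> u (Suc n) = 2 *\<^sub>R (u n - snd (p n))" ..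
    then have p: "\<And>n. p n \<in> K" "\<And>n. fst (p n) \<in> V n"
      and rec: "\<And>n. u (Suc n) = 2 *\<^sub>R (u n - snd (p n))"
      by simp_all
    define q where "q n = (\<Sum>k<n. (1/2)^(Suc k) *\<^sub>R p k)" for n
    have "q n \<in> K" for n
      unfolding q_def using convex_sum_halves[OF assms(2)] assms(3) p(1) by (simp add: zero_prod_def)
    have fst_q: "fst (q n) = (\<Sum>k<n. (1/2)^(Suc k) *\<^sub>R fst (p k))" for n
      unfolding q_def by (simp add: fst_sum)
    have "(1/2)^(Suc k) *\<^sub>R fst (p k) \<in> V k" for k
      using V(2,3) p(2) by (intro convex_scale_mem power_le_one) auto
    then have "summable (\<lambda>k. (1/2)^(Suc k) *\<^sub>R fst (p k))" using V_all by simp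
    then obtain x where x: "(\<lambda>n. fst (q n)) \<longlonglongrightarrow> x"
      unfolding fst_q summable_def sums_def by blast
    have snd_q: "snd (q n) = z + (- 1) *\<^sub>R ((1/2)^(Suc n) *\<^sub>R u n)" for n
    proof (induction n)
      case 0
      then show ?case by (simp add: q_def u(2))
    next
      case (Suc n)
      have "snd (q (Suc n)) = snd (q n) + (1/2)^(Suc n) *\<^sub>R snd (p n)"
        by (simp add: q_def)
      then show ?case unfolding Suc rec by (simp add: algebra_simps)
    qed
    have "u \<longlonglongrightarrow> 0"
      using u(1) W(4) V'_all by (intro summable_imp_tendsto_0) blast
    moreover have "(\<lambda>n. (1/2::real)^(Suc n)) \<longlonglongrightarrow> 0"
      by (intro LIMSEQ_Suc LIMSEQ_power_zero) simp
    ultimately have "(\<lambda>n. snd (q n)) \<longlonglongrightarrow> z + (- 1) *\<^sub>R (0 *\<^sub>R 0)"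
      unfolding snd_q by (intro tendsto_add tendsto_const tendsto_scaleR_tvs)
    then have "(\<lambda>n. (fst (q n), snd (q n))) \<longlonglongrightarrow> (x, z)"
      using x by (intro tendsto_Pair) simp_all
    then have "(x, z) \<in> K"
      using \<open>\<And>n. q n \<in> K\<close> Lim_in_closed_set[OF assms(1), of "\<lambda>n. (fst (q n), snd (q n))" sequentially]
      by simp
    then show ?thesis by force
  qed
  then have "{z. 2 *\<^sub>R z + 0 \<in> W 0} \<subseteq> snd ` K" by auto
  moreover have "0 \<in> {z. 2 *\<^sub>R z + 0 \<in> W 0}" using W by simp
  ultimately show ?thesis using open_affine_vimage[OF W(1)] interiorI by metis
qed

lemma closed_convex_range_core_imp_interior:
  fixes K :: "('x::frechet_space \<times> 'z::frechet_space) set"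
  assumes "closed K" "convex K" and core: "0 \<in> core (snd ` K)"
  shows "0 \<in> interior (snd ` K)"
proof -
  obtain x where x: "(x, 0) \<in> K" using core by (auto simp: core_0_iff)
  define K' where "K' = (\<lambda>p. p + (x, 0)) -` K"
  have "snd ` K' = snd ` K"
  proof
    show "snd ` K' \<subseteq> snd ` K" unfolding K'_def by force
    have "(y, z) \<in> K \<Longrightarrow> (y - x, z) \<in> K'" for y z by (simp add: K'_def)
    then show "snd ` K \<subseteq> snd ` K'" by force
  qed
  moreover have "closed K'"
    unfolding K'_def
  proof (rule closed_vimage[OF assms(1)])
    have "continuous_on UNIV (\<lambda>p :: 'x \<times> 'z. (fst p + x, snd p))"
      unfolding continuous_on_def
      by (intro ballI tendsto_Pair tendsto_add tendsto_fst tendsto_snd tendsto_const tendsto_ident_at)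
    moreover have "(\<lambda>p :: 'x \<times> 'z. (fst p + x, snd p)) = (\<lambda>p. p + (x, 0))"
      by (auto simp: fun_eq_iff)
    ultimately show "continuous_on UNIV (\<lambda>p :: 'x \<times> 'z. p + (x, 0))" by metis
  qed
  moreover have "convex K'"
    unfolding K'_def vimage_def
  proof (rule convexI, unfold mem_Collect_eq)
    fix p q and s t :: real
    assume *: "p + (x, 0) \<in> K" "q + (x, 0) \<in> K" "0 \<le> s" "0 \<le> t" "s + t = 1"
    have "s *\<^sub>R p + t *\<^sub>R q + (x, 0) = s *\<^sub>R (p + (x, 0)) + t *\<^sub>R (q + (x, 0))"
      using scaleR_left_distrib[of s t "(x, 0)"] *(5) by (simp add: scaleR_right_distrib)
    then show "s *\<^sub>R p + t *\<^sub>R q + (x, 0) \<in> K" using convexD[OF assms(2)] * by auto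
  qed
  moreover have "(0, 0) \<in> K'" using x by (simp add: K'_def)
  ultimately show ?thesis using closed_convex_range_interior_0[of K'] core by metis
qed

section \<open>The epigraph of the perturbed problem\<close>

lemma convex_cone_add: "is_convex_cone C \<Longrightarrow> a \<in> C \<Longrightarrow> b \<in> C \<Longrightarrow> a + b \<in> C"
  unfolding is_convex_cone_def by (auto simp: set_plus_def)

lemma convex_cone_scale: "is_convex_cone C \<Longrightarrow> a \<in> C \<Longrightarrow> t \<ge> 0 \<Longrightarrow> t *\<^sub>R a \<in> C"
  unfolding is_convex_cone_def cone_of_def by blast

lemma top_le_Elem_iff: "top_le C u (Elem z) \<longleftrightarrow> (\<exists>y. u = Elem y \<and> z - y \<in> C)"
  by (cases u) auto

text \<open>
  The relation \<open>g x \<le>\<^sub>C z\<close> describes the epigraph of \<open>g\<close>, which lies over the domain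
  of \<open>g\<close>. So both values of \<open>g\<close> are elements of the space, and the three membership relations in
  \<open>C\<close>, two from the epigraph and one from \<open>C\<close>-convexity, can be added with weights.
\<close>

lemma cone_convex_combine:
  assumes C: "is_convex_cone C" and g: "cone_convex C g"
    and x: "top_le C (g x) (Elem z)" and x': "top_le C (g x') (Elem z')"
    and t: "0 \<le> t" "t \<le> 1"
  shows "top_le C (g (t *\<^sub>R x + (1 - t) *\<^sub>R x')) (Elem (t *\<^sub>R z + (1 - t) *\<^sub>R z'))"
proof -
  obtain y y' where y: "g x = Elem y" "z - y \<in> C" "g x' = Elem y'" "z' - y' \<in> C"
    using x x' by (auto simp: top_le_Elem_iff)
  have "top_le C (g (t *\<^sub>R x + (1 - t) *\<^sub>R x')) (Elem (t *\<^sub>R y + (1 - t) *\<^sub>R y'))"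
    using g t y(1,3) unfolding cone_convex_def by (metis atLeastAtMost_iff top_add.simps(1) top_scale.simps(1))
  then obtain w where w: "g (t *\<^sub>R x + (1 - t) *\<^sub>R x') = Elem w"
    "(t *\<^sub>R y + (1 - t) *\<^sub>R y') - w \<in> C"
    by (auto simp: top_le_Elem_iff)
  have "t *\<^sub>R (z - y) + (1 - t) *\<^sub>R (z' - y') \<in> C"
    using t y by (intro convex_cone_add convex_cone_scale C) auto
  from convex_cone_add[OF C this w(2)]
  have "t *\<^sub>R z + (1 - t) *\<^sub>R z' - w \<in> C" by (simp add: scaleR_right_diff_distrib)
  then show ?thesis using w(1) by (simp add: top_le_Elem_iff)
qed

lemma econvex_combine:
  assumes f: "econvex f" and x: "f x \<le> ereal r" and x': "f x' \<le> ereal r'"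
    and t: "0 \<le> t" "t \<le> 1"
  shows "f (t *\<^sub>R x + (1 - t) *\<^sub>R x') \<le> ereal (t * r + (1 - t) * r')"
proof -
  have "f (t *\<^sub>R x + (1 - t) *\<^sub>R x') \<le> ereal t * f x + ereal (1 - t) * f x'"
    using f t unfolding econvex_def by auto
  also have "\<dots> \<le> ereal t * ereal r + ereal (1 - t) * ereal r'"
    using t x x' by (intro add_mono ereal_mult_left_mono) auto
  finally show ?thesis by simp
qed

text \<open>
  The projection of this set to \<open>(z, r)\<close> has as its lower boundary the value function
  \<open>z \<mapsto> inf {f x | x \<in> S, g x \<le>\<^sub>C z}\<close>.
\<close>

definition perturbation_epi ::
    "'z::real_vector set \<Rightarrow> 'x set \<Rightarrow> ('x \<Rightarrow> ereal) \<Rightarrow> ('x \<Rightarrow> 'z with_top) \<Rightarrow> ('x \<times> 'z \<times> real) set" where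
  "perturbation_epi C S f g = {(x, z, r). x \<in> S \<and> f x \<le> ereal r \<and> top_le C (g x) (Elem z)}"

lemma perturbation_epi_combine:
  assumes "is_convex_cone C" "convex S" "econvex f" "cone_convex C g"
    and "(x, z, r) \<in> perturbation_epi C S f g" "(x', z', r') \<in> perturbation_epi C S f g"
    and "0 \<le> t" "t \<le> 1"
  shows "(t *\<^sub>R x + (1 - t) *\<^sub>R x', t *\<^sub>R z + (1 - t) *\<^sub>R z', t * r + (1 - t) * r')
    \<in> perturbation_epi C S f g"
  using assms cone_convex_combine[OF assms(1,4)] econvex_combine[OF assms(3)] convexD[OF assms(2)]
  unfolding perturbation_epi_def by simp

lemma Gset_eq:
  assumes "eproper f"
  shows "Gset C S f g = {z. \<exists>x r. (x, z, r) \<in> perturbation_epi C S f g}"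
proof (intro set_eqI iffI)
  fix z assume "z \<in> Gset C S f g"
  then obtain x y c where *: "x \<in> edom f" "x \<in> S" "g x = Elem y" "c \<in> C" "z = y + c"
    unfolding Gset_def by auto
  have "f x \<le> ereal (real_of_ereal (f x))"
    using *(1) assms by (cases "f x") (auto simp: edom_def eproper_def)
  then show "z \<in> {z. \<exists>x r. (x, z, r) \<in> perturbation_epi C S f g}"
    using * by (auto simp: perturbation_epi_def)
next
  fix z assume "z \<in> {z. \<exists>x r. (x, z, r) \<in> perturbation_epi C S f g}"
  then obtain x r y where *: "x \<in> S" "f x \<le> ereal r" "g x = Elem y" "z - y \<in> C"
    by (auto simp: perturbation_epi_def top_le_Elem_iff)
  have "x \<in> edom f" using *(2) by (auto simp: edom_def intro: le_less_trans)
  moreover have "z = y + (z - y)" by simp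
  ultimately show "z \<in> Gset C S f g"
    using * unfolding Gset_def tdom_def by blast
qed

text \<open>
  The slack \<open>z \<in> C\<close> in \<open>\<E>\<close> expresses \<open>g x \<le>\<^sub>C z\<close>, and the slack \<open>\<epsilon> \<ge> 0\<close> expresses an upper bound on \<open>f x\<close>.
\<close>

lemma Eset_iff:
  assumes "eproper f"
  shows "(z, r) \<in> Eset C S f g \<longleftrightarrow>
    (\<exists>x. (x, z, r + real_of_ereal (vPL C S f g)) \<in> perturbation_epi C S f g)"
proof
  let ?v = "real_of_ereal (vPL C S f g)"
  assume "(z, r) \<in> Eset C S f g"
  then obtain x y c e where *: "x \<in> edom f" "x \<in> S" "g x = Elem y" "c \<in> C" "e \<ge> 0"
    "z = y + c" "r = real_of_ereal (f x) - ?v + e"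
    unfolding Eset_def by blast
  have "f x \<le> ereal (r + ?v)"
    using *(1,5,7) assms by (cases "f x") (auto simp: edom_def eproper_def)
  then show "\<exists>x. (x, z, r + ?v) \<in> perturbation_epi C S f g"
    using * by (auto simp: perturbation_epi_def)
next
  let ?v = "real_of_ereal (vPL C S f g)"
  assume "\<exists>x. (x, z, r + ?v) \<in> perturbation_epi C S f g"
  then obtain x y where *: "x \<in> S" "f x \<le> ereal (r + ?v)" "g x = Elem y" "z - y \<in> C"
    by (auto simp: perturbation_epi_def top_le_Elem_iff)
  have x: "x \<in> edom f \<inter> S \<inter> tdom g"
    using * by (auto simp: edom_def tdom_def intro: le_less_trans)
  have "f x > -\<infinity>" using assms by (auto simp: eproper_def)
  then have "r + ?v - real_of_ereal (f x) \<ge> 0" using *(2) by (cases "f x") auto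
  moreover have "z = y + (z - y)"
    "r = real_of_ereal (f x) - ?v + (r + ?v - real_of_ereal (f x))" by simp_all
  ultimately show "(z, r) \<in> Eset C S f g"
    unfolding Eset_def using x *(3,4) by blast
qed

lemma convex_Eset:
  assumes "is_convex_cone C" "convex S" "eproper f" "econvex f" "cone_convex C g"
  shows "convex (Eset C S f g)"
proof -
  let ?v = "real_of_ereal (vPL C S f g)"
  have "(t * r + (1 - t) * r') + ?v = t * (r + ?v) + (1 - t) * (r' + ?v)" for t r r'
    by (simp add: algebra_simps)
  then have "(t *\<^sub>R z + (1 - t) *\<^sub>R z', t * r + (1 - t) * r') \<in> Eset C S f g"
    if "(z, r) \<in> Eset C S f g" "(z', r') \<in> Eset C S f g" "0 \<le> t" "t \<le> 1" for z z' r r' t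
    using that perturbation_epi_combine[OF assms(1,2,4,5)] unfolding Eset_iff[OF assms(3)]
    by metis
  then show ?thesis unfolding convex_alt by (auto simp: add.commute)
qed

lemma Eset_0_nonneg:
  fixes C :: "'z::real_vector set"
  assumes "eproper f" "\<bar>vPL C S f g\<bar> \<noteq> \<infinity>" "(0, r) \<in> Eset C S f g"
  shows "r \<ge> 0"
proof -
  let ?v = "real_of_ereal (vPL C S f g)"
  obtain x y where *: "x \<in> S" "f x \<le> ereal (r + ?v)" "g x = Elem y" "- y \<in> C"
    using assms(3) unfolding Eset_iff[OF assms(1)]
    by (auto simp: perturbation_epi_def top_le_Elem_iff)
  have "g x \<in> neg_top C"
    unfolding neg_top_def using *(3,4) by (intro image_eqI[of _ _ "- y"]) auto
  then have "vPL C S f g \<le> f x"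
    unfolding vPL_def using *(1) by (intro Inf_lower) blast
  also note *(2)
  finally show ?thesis using assms(2) by (cases "vPL C S f g") auto
qed

section \<open>The value function is bounded above near the origin\<close>

lemma closed_sublevel:
  assumes "lsc f"
  shows "closed {x. f x \<le> a}"
proof -
  have "open {x. a < f x}"
  proof (subst open_subopen, intro ballI)
    fix x assume "x \<in> {x. a < f x}"
    then have "\<forall>\<^sub>F y in nhds x. a < f y" using assms unfolding lsc_def by simp
    then show "\<exists>U. open U \<and> x \<in> U \<and> U \<subseteq> {x. a < f x}"
      unfolding eventually_nhds by (simp add: subset_eq)
  qed
  moreover have "- {x. a < f x} = {x. f x \<le> a}" by auto
  ultimately show ?thesis by (metis closed_Compl)
qed

text \<open>
  Take a point \<open>(x0, 0, r0)\<close> of the epigraph and \<open>m = r0 + 1\<close>. Every point \<open>(x, u, r)\<close> of the epigraph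
  becomes a point of height at most \<open>m\<close> when it is moved far enough towards \<open>(x0, 0, r0)\<close>, which
  multiplies \<open>u\<close> by a positive factor. So the slice at height \<open>m\<close>, which is closed by the closedness
  hypotheses on \<open>S\<close>, \<open>f\<close> and \<open>g\<close>, still projects to an absorbing set.
\<close>

lemma core_Gset_imp_interior_slice:
  fixes C :: "'z::frechet_space set" and S :: "'x::frechet_space set"
  assumes C: "is_convex_cone C" and S: "convex S" "closed S"
    and f: "eproper f" "econvex f" "lsc f" and g: "cone_convex C g" "cone_epi_closed C g"
    and core: "0 \<in> core (Gset C S f g)"
  obtains m where "0 \<in> interior {z. \<exists>x. (x, z, m) \<in> perturbation_epi C S f g}"
proof -
  let ?Q = "perturbation_epi C S f g"
  note combine = perturbation_epi_combine[OF C S(1) f(2) g(1)]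
  obtain x0 r0 where x0: "(x0, 0, r0) \<in> ?Q"
    using core unfolding core_0_iff Gset_eq[OF f(1)] by auto
  define m where "m = r0 + 1"
  define K where "K = {(x, z). (x, z, m) \<in> ?Q}"
  have slice: "snd ` K = {z. \<exists>x. (x, z, m) \<in> ?Q}"
    unfolding K_def by force
  have mono: "(x, z, r) \<in> ?Q \<Longrightarrow> r \<le> m \<Longrightarrow> (x, z, m) \<in> ?Q" for x z r
    unfolding perturbation_epi_def by (auto intro: order_trans)
  have "K = (S \<times> UNIV) \<inter> ({x. f x \<le> ereal m} \<times> UNIV) \<inter> {(x, z). top_le C (g x) (Elem z)}"
    unfolding K_def perturbation_epi_def by auto
  then have "closed K"
    using g(2) S(2) f(3) unfolding cone_epi_closed_def
    by (simp add: closed_Int closed_Times closed_sublevel)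
  moreover have "convex K"
    unfolding convex_alt
  proof (intro ballI allI impI, elim conjE)
    fix p q and t :: real
    assume *: "p \<in> K" "q \<in> K" "0 \<le> t" "t \<le> 1"
    have "t * m + (1 - t) * m = m" by (simp add: algebra_simps)
    then show "(1 - t) *\<^sub>R p + t *\<^sub>R q \<in> K"
      using * combine[of "fst q" "snd q" m "fst p" "snd p" m t] unfolding K_def
      by (auto simp: add.commute split: prod.splits)
  qed
  moreover have "0 \<in> core (snd ` K)"
    unfolding core_0_iff slice
  proof (intro conjI allI)
    show "0 \<in> {z. \<exists>x. (x, z, m) \<in> ?Q}" using mono[OF x0] by (auto simp: m_def)
    fix z
    obtain s u x r where s: "s \<ge> 0" "(x, u, r) \<in> ?Q" "z = s *\<^sub>R u"
      using core unfolding core_0_iff Gset_eq[OF f(1)] by blast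
    define t where "t = 1 / (1 + \<bar>r - r0\<bar>)"
    have t: "0 < t" "t \<le> 1" by (auto simp: t_def)
    have "t * (r - r0) \<le> 1"
      using abs_ge_self[of "r - r0"] by (simp add: t_def)
    then have "t * r + (1 - t) * r0 \<le> m" by (simp add: m_def algebra_simps)
    then have "(t *\<^sub>R x + (1 - t) *\<^sub>R x0, t *\<^sub>R u, m) \<in> ?Q"
      using mono combine[OF s(2) x0, of t] t by simp
    moreover have "z = (s / t) *\<^sub>R (t *\<^sub>R u)" "s / t \<ge> 0" using s t by auto
    ultimately show "\<exists>s\<ge>0. \<exists>u\<in>{z. \<exists>x. (x, z, m) \<in> ?Q}. z = s *\<^sub>R u" by blast
  qed
  ultimately have "0 \<in> interior (snd ` K)" by (rule closed_convex_range_core_imp_interior)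
  then show ?thesis unfolding slice by (rule that)
qed

section \<open>Quasi-interiors\<close>

lemma cone_of_convex_hull_insert_0:
  assumes "convex E" "E \<noteq> {}" "p \<in> cone_of (convex hull (insert 0 E))"
  obtains t e where "t \<ge> 0" "e \<in> E" "p = t *\<^sub>R e"
proof -
  obtain s b where s: "s \<ge> 0" "b \<in> convex hull (insert 0 E)" "p = s *\<^sub>R b"
    using assms(3) unfolding cone_of_def by auto
  then obtain v e where "v \<ge> 0" "e \<in> E" "b = v *\<^sub>R e"
    unfolding convex_hull_insert[OF assms(2)] hull_same[of convex, OF assms(1)] by auto
  then show ?thesis using s that[of "s * v" e] by simp
qed

text \<open>
  As \<open>(0, M) \<in> E\<close>, the cone generated by \<open>E\<close> contains \<open>(0, 1)\<close>. If its closure were a subspace, it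
  would also contain \<open>(0, -1)\<close>. Then there would be \<open>t \<ge> 0\<close> and \<open>(z, r) \<in> E\<close> with
  \<open>t r < - 1/2\<close> and \<open>t z\<close> as close to \<open>0\<close> as desired. The segment from \<open>(z, r)\<close> to
  \<open>(- s z, M)\<close> meets the vertical axis at height \<open>(s r + M) / (1 + s)\<close>, which must be nonnegative. For
  \<open>s = 4 M t\<close> it is negative, as \<open>s r < - 2 M\<close>, and \<open>- s z\<close> is still in \<open>W\<close> if \<open>t z\<close> is close
  enough to \<open>0\<close>.
\<close>

lemma not_qri_of_locally_bounded:
  fixes E :: "('z::real_tvs \<times> real) set"
  assumes "convex E" and nonneg: "\<And>r. (0, r) \<in> E \<Longrightarrow> r \<ge> 0"
    and W: "open W" "0 \<in> W" "\<And>w. w \<in> W \<Longrightarrow> (w, M) \<in> E" and "M > 0"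
  shows "(0, 0) \<notin> qri (convex hull (E \<union> {(0, 0)}))"
proof
  let ?H = "convex hull (insert 0 E)"
  assume "(0, 0) \<in> qri (convex hull (E \<union> {(0, 0)}))"
  then have "subspace (closure (cone_of ?H))"
    unfolding qri_def by (simp flip: zero_prod_def)
  moreover have "(0, 1) \<in> closure (cone_of ?H)"
  proof -
    have "(0, M) \<in> ?H" using W by (intro hull_inc) auto
    moreover have "(0, 1) = inverse M *\<^sub>R (0, M)" using \<open>M > 0\<close> by simp
    moreover have "inverse M \<ge> 0" using \<open>M > 0\<close> by simp
    ultimately have "(0, 1) \<in> cone_of ?H" unfolding cone_of_def by blast
    then show ?thesis using closure_subset by blast
  qed
  ultimately have cl: "(0, -1) \<in> closure (cone_of ?H)"
    using subspace_neg[of "closure (cone_of ?H)" "(0, 1)"] by simp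
  define N where "N = {z. (- (4 * M)) *\<^sub>R z + 0 \<in> W} \<times> {..< (- 1 / 2 :: real)}"
  have "open N" unfolding N_def by (intro open_Times open_affine_vimage W) auto
  moreover have "(0, -1) \<in> N" using W by (simp add: N_def)
  ultimately obtain p where "p \<in> N" "p \<in> cone_of ?H"
    using cl open_Int_closure_eq_empty[of N "cone_of ?H"] by blast
  moreover have "E \<noteq> {}" using W by auto
  ultimately obtain t z r where t: "t \<ge> 0" "(z, r) \<in> E" "p = t *\<^sub>R (z, r)"
    using cone_of_convex_hull_insert_0[OF assms(1)] by (metis surj_pair)
  define s where "s = 4 * M * t"
  have N: "(- s) *\<^sub>R z \<in> W" "t * r < - 1 / 2"
    using \<open>p \<in> N\<close> t by (auto simp: N_def s_def)
  have s: "s \<ge> 0" using t \<open>M > 0\<close> by (simp add: s_def)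
  have "(s / (1 + s)) *\<^sub>R (z, r) + (1 / (1 + s)) *\<^sub>R ((- s) *\<^sub>R z, M) \<in> E"
    using s t W(3)[OF N(1)] by (intro convexD[OF assms(1)]) (auto simp: field_simps)
  then have "(0, (s * r + M) / (1 + s)) \<in> E"
    by (simp add: add_divide_distrib)
  then have "0 \<le> (s * r + M) / (1 + s)" by (rule nonneg)
  then have "0 \<le> s * r + M" using s by (simp add: divide_simps split: if_splits)
  moreover have "s * r < - (2 * M)"
    using mult_strict_left_mono[OF N(2), of "4 * M"] \<open>M > 0\<close> by (simp add: s_def mult.assoc)
  ultimately show False using \<open>M > 0\<close> by linarith
qed

text \<open>
  If the closed cone \<open>L\<close> generated by \<open>G\<close> is a subspace, it contains \<open>G - G\<close> and hence the closed
  cone generated by \<open>G - G\<close>; the reverse inclusion of cones holds because \<open>0 \<in> G\<close>.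
\<close>

lemma qi_iff_qri_and_qi_set_diff:
  assumes "0 \<in> G"
  shows "0 \<in> qi G \<longleftrightarrow> 0 \<in> qi (set_diff_of G G) \<and> 0 \<in> qri G"
proof
  have sub: "cone_of G \<subseteq> cone_of (set_diff_of G G)"
    using assms unfolding cone_of_def set_diff_of_def by force
  assume "0 \<in> qi G"
  then have UNIV: "closure (cone_of G) = UNIV" unfolding qi_def by simp
  then have "closure (cone_of (set_diff_of G G)) = UNIV" using closure_mono[OF sub] by auto
  moreover have "0 \<in> set_diff_of G G" using assms unfolding set_diff_of_def by force
  ultimately show "0 \<in> qi (set_diff_of G G) \<and> 0 \<in> qri G"
    using assms UNIV unfolding qi_def qri_def by simp
next
  assume *: "0 \<in> qi (set_diff_of G G) \<and> 0 \<in> qri G"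
  let ?L = "closure (cone_of G)"
  have L: "subspace ?L" using * unfolding qri_def by simp
  have "G \<subseteq> cone_of G" unfolding cone_of_def by (force intro: bexI[of _ 1])
  then have "G \<subseteq> ?L" using closure_subset by blast
  then have "t *\<^sub>R (u - v) \<in> ?L" if "u \<in> G" "v \<in> G" for t u v
    using that by (intro subspace_scale[OF L] subspace_diff[OF L]) auto
  then have "cone_of (set_diff_of G G) \<subseteq> ?L"
    unfolding set_diff_of_def cone_of_def[of "{u - v |u v. u \<in> G \<and> v \<in> G}"] by blast
  then have "closure (cone_of (set_diff_of G G)) \<subseteq> ?L" by (rule closure_minimal) simp
  then show "0 \<in> qi G" using * assms unfolding qi_def by auto
qed

section \<open>The regularity conditions\<close>

theorem proposition34:
  fixes C :: "'z::frechet_space set"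
    and S :: "'x::frechet_space set"
    and f :: "'x \<Rightarrow> ereal"
    and g :: "'x \<Rightarrow> 'z with_top"
  assumes "C \<noteq> {}" and "is_convex_cone C"
    and "S \<noteq> {}" and "convex S" and "closed S"
    and "eproper f" and "econvex f" and "lsc f"
    and "tproper g" and "cone_convex C g" and "cone_epi_closed C g"
    and "edom f \<inter> S \<inter> g -` neg_top C \<noteq> {}"
    and "\<bar>vPL C S f g\<bar> \<noteq> \<infinity>"
  shows "(RC1 C S f g \<longrightarrow> RC2 C S f g) \<and>
         (RC2 C S f g \<longleftrightarrow> RC3 C S f g) \<and>
         (RC3 C S f g \<longrightarrow> RC6 C S f g) \<and>
         (RC6 C S f g \<longleftrightarrow> RC7 C S f g)"
proof (intro conjI impI)
  let ?G = "Gset C S f g" and ?E = "Eset C S f g" and ?Q = "perturbation_epi C S f g"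
  have slice: "{z. \<exists>x. (x, z, m) \<in> ?Q} \<subseteq> ?G" for m
    unfolding Gset_eq[OF assms(6)] by blast
  show "RC2 C S f g" if rc1: "RC1 C S f g"
  proof -
    obtain x c where x: "x \<in> edom f" "x \<in> S" "c \<in> interior C" "g x = Elem (- c)"
      using rc1 unfolding RC1_def neg_top_def by blast
    have "{z. 1 *\<^sub>R z + c \<in> interior C} \<subseteq> ?G"
    proof
      fix z assume "z \<in> {z. 1 *\<^sub>R z + c \<in> interior C}"
      then have "z + c \<in> C" using interior_subset by auto
      moreover have "z = - c + (z + c)" by simp
      ultimately show "z \<in> ?G" using x unfolding Gset_def tdom_def by blast
    qed
    moreover have "0 \<in> {z. 1 *\<^sub>R z + c \<in> interior C}" using x by simp
    ultimately show ?thesis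
      unfolding RC2_def using interiorI[OF open_affine_vimage[OF open_interior]] by blast
  qed
  show "RC2 C S f g \<longleftrightarrow> RC3 C S f g"
  proof
    assume "RC3 C S f g"
    then obtain m where "0 \<in> interior {z. \<exists>x. (x, z, m) \<in> ?Q}"
      unfolding RC3_def
      using core_Gset_imp_interior_slice[OF assms(2,4,5,6,7,8,10,11)] by metis
    then show "RC2 C S f g" unfolding RC2_def using interior_mono[OF slice] by blast
  qed (simp add: RC2_def RC3_def interior_0_imp_core_0)
  show "RC6 C S f g" if rc3: "RC3 C S f g"
    unfolding RC6_def
  proof
    show "0 \<in> qi ?G" using rc3 unfolding RC3_def core_def qi_def by simp
    obtain m where m: "0 \<in> interior {z. \<exists>x. (x, z, m) \<in> ?Q}"
      using rc3 unfolding RC3_def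
      using core_Gset_imp_interior_slice[OF assms(2,4,5,6,7,8,10,11)] by metis
    \<comment> \<open>The maximum with 1 provides a strictly positive bound.\<close>
    define M where "M = max 1 (m - real_of_ereal (vPL C S f g))"
    have "(w, M) \<in> ?E" if "w \<in> interior {z. \<exists>x. (x, z, m) \<in> ?Q}" for w
    proof -
      obtain x where "(x, w, m) \<in> ?Q" using \<open>w \<in> interior _\<close> interior_subset by blast
      moreover have "m \<le> M + real_of_ereal (vPL C S f g)" by (simp add: M_def)
      ultimately have "(x, w, M + real_of_ereal (vPL C S f g)) \<in> ?Q"
        unfolding perturbation_epi_def by (auto intro: order_trans)
      then show ?thesis unfolding Eset_iff[OF assms(6)] by blast
    qed
    then show "(0, 0) \<notin> qri (convex hull (?E \<union> {(0, 0)}))"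
      using m by (intro not_qri_of_locally_bounded[OF convex_Eset[OF assms(2,4,6,7,10)]
          Eset_0_nonneg[OF assms(6,13)] open_interior]) (auto simp: M_def)
  qed
  have "0 \<in> ?G"
  proof -
    obtain x c where "x \<in> edom f" "x \<in> S" "g x = Elem (- c)" "c \<in> C"
      using assms(12) unfolding neg_top_def by blast
    moreover have "0 = - c + c" by simp
    ultimately show ?thesis unfolding Gset_def tdom_def by blast
  qed
  then show "RC6 C S f g \<longleftrightarrow> RC7 C S f g"
    unfolding RC6_def RC7_def using qi_iff_qri_and_qi_set_diff by blast
qed

end
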